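(* Let $n\ge 1$ and let $c_1,\ldots,c_n$ be positive integers. Let $x=[0,\overline{c_1,\ldots,c_n}]$ be the real number with the periodic simple continued fraction expansion whose initial digit is $0$ and whose repeating block is $c_1,\ldots,c_n$; $x$ is a quadratic irrational, so $x=a+\sqrt b$ with $a,b\in\mathbb{Q}$, $b>0$ not a square. Let $x_q=a$ denote the rational part of $x$. Then \[ 2x_q=-c_n+\varepsilon, \] where $\varepsilon$ is a real (indeed rational) number with $|\varepsilon|<1$ that depends only on $c_1,\ldots,c_{n-1}$ (that is, for any positive integer $c_n'$, the number $\tilde x=[0,\overline{c_1,\ldots,c_{n-1},c_n'}]$ satisfies $2\tilde x_q+c_n'=2x_q+c_n=\varepsilon$). In particular, the fractional part $\{2x_q\}$ depends only on $c_1,\ldots,c_{n-1}$ and not on $c_n$.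
   Context: A simple continued fraction $[c_0,c_1,c_2,\ldots]$ has $c_0\in\mathbb{Z}$ and $c_k$ positive integers for $k\ge1$; $[0,\overline{c_1,\ldots,c_n}]$ denotes $[0,c_1,\ldots,c_n,c_1,\ldots,c_n,\ldots]$. Every quadratic irrational $x$ can be written uniquely as $x=a+\sqrt b$ with $a,b$ rational, $b>0$ not a square, where $\sqrt b$ denotes a (positive or negative) real square root of $b$; $a$ is called the rational part of $x$, written $x_q$. For a rational number $r$, the fractional part $\{r\}$ is the unique number with $r-\{r\}\in\mathbb{Z}$ and $0\le\{r\}<1$. *)

theory Defs
  imports Complex_Main
begin

fun cfrac_conv :: "(nat \<Rightarrow> int) \<Rightarrow> nat \<Rightarrow> real" where
  "cfrac_conv c 0 = of_int (c 0)"
| "cfrac_conv c (Suc k) = of_int (c 0) + 1 / cfrac_conv (\<lambda>i. c (Suc i)) k"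

definition cfrac_value :: "(nat \<Rightarrow> int) \<Rightarrow> real" where
  "cfrac_value c = lim (cfrac_conv c)"

definition periodic_digits :: "nat \<Rightarrow> (nat \<Rightarrow> int) \<Rightarrow> nat \<Rightarrow> int" where
  "periodic_digits n c k = (if k = 0 then 0 else c ((k - 1) mod n + 1))"

definition periodic_cfrac :: "nat \<Rightarrow> (nat \<Rightarrow> int) \<Rightarrow> real" where
  "periodic_cfrac n c = cfrac_value (periodic_digits n c)"

definition quadratic_irrational :: "real \<Rightarrow> bool" where
  "quadratic_irrational x \<longleftrightarrow>
     x \<notin> \<rat> \<and> (\<exists>p q r :: rat. p \<noteq> 0 \<and> of_rat p * x\<^sup>2 + of_rat q * x + of_rat r = 0)"

definition surd_form :: "real \<Rightarrow> rat \<Rightarrow> rat \<Rightarrow> bool" where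
  "surd_form x a b \<longleftrightarrow> b > 0 \<and> (\<nexists>r :: rat. b = r\<^sup>2) \<and>
     (x = of_rat a + sqrt (of_rat b) \<or> x = of_rat a - sqrt (of_rat b))"

definition rational_part :: "real \<Rightarrow> rat" where
  "rational_part x = (THE a. \<exists>b. surd_form x a b)"

lemma cfrac_conv_bounds:
  assumes "\<And>k. k \<ge> 1 \<Longrightarrow> c k > 0"
  shows "of_int (c 0) \<le> cfrac_conv c k \<and> cfrac_conv c k \<le> of_int (c 0) + 1"
  using assms
proof (induction k arbitrary: c)
  case 0
  then show ?case by simp
next
  case (Suc k)
  have "of_int (c 1) \<le> cfrac_conv (\<lambda>i. c (Suc i)) k"
    using Suc.IH[of "\<lambda>i. c (Suc i)"] Suc.prems by simp
  moreover have "c 1 \<ge> 1" using Suc.prems[of 1] by simp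
  ultimately have "cfrac_conv (\<lambda>i. c (Suc i)) k \<ge> 1"
    by (smt (verit) of_int_1_le_iff)
  then show ?case by simp
qed

lemma cfrac_conv_contract:
  assumes "\<And>k. k \<ge> 1 \<Longrightarrow> c k > 0" and "k \<ge> 2 * j" and "m \<ge> 2 * j"
  shows "\<bar>cfrac_conv c k - cfrac_conv c m\<bar> \<le> (1/4) ^ j"
  using assms
proof (induction j arbitrary: c k m)
  case 0
  then show ?case
    using cfrac_conv_bounds[of c k] cfrac_conv_bounds[of c m] by fastforce
next
  case (Suc j)
  obtain k' where k: "k = Suc (Suc k')" using Suc.prems(2) by (cases k; cases "k - 1") auto
  obtain m' where m: "m = Suc (Suc m')" using Suc.prems(3) by (cases m; cases "m - 1") auto
  let ?d = "\<lambda>i. c (Suc (Suc i))"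
  define y z a where "y = cfrac_conv ?d k'" and "z = cfrac_conv ?d m'"
    and "a = real_of_int (c 1)"
  have pos: "\<And>k. k \<ge> 1 \<Longrightarrow> ?d k > 0" using Suc.prems(1) by simp
  have IH: "\<bar>y - z\<bar> \<le> (1/4) ^ j"
    unfolding y_def z_def using Suc.prems(2,3) k m by (intro Suc.IH[OF pos]) auto
  have d0: "real_of_int (?d 0) \<ge> 1" using Suc.prems(1)[of 2] by (simp add: numeral_2_eq_2)
  have y: "y \<ge> 1" using cfrac_conv_bounds[of ?d k', OF pos] d0 unfolding y_def by linarith
  have z: "z \<ge> 1" using cfrac_conv_bounds[of ?d m', OF pos] d0 unfolding z_def by linarith
  have a: "a \<ge> 1" using Suc.prems(1)[of 1] unfolding a_def by simp
  have ay: "a * y \<ge> 1" and az: "a * z \<ge> 1"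
    using mult_mono[of 1 a 1 y] mult_mono[of 1 a 1 z] a y z by auto
  have eq: "cfrac_conv c k - cfrac_conv c m = 1 / (a + 1 / y) - 1 / (a + 1 / z)"
    unfolding k m y_def z_def a_def by simp
  have ry: "1 / (a + 1 / y) = y / (a * y + 1)" and rz: "1 / (a + 1 / z) = z / (a * z + 1)"
    using y z by (simp_all add: field_simps)
  have "y / (a * y + 1) - z / (a * z + 1) = (y - z) / ((a * y + 1) * (a * z + 1))"
    using ay az by (simp add: divide_simps) (simp add: algebra_simps)
  then have e2: "\<bar>cfrac_conv c k - cfrac_conv c m\<bar> = \<bar>y - z\<bar> / ((a * y + 1) * (a * z + 1))"
    using eq ry rz ay az by (simp add: abs_mult)
  have "(a * y + 1) * (a * z + 1) \<ge> 2 * 2" using ay az by (intro mult_mono) auto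
  then have "\<bar>y - z\<bar> / ((a * y + 1) * (a * z + 1)) \<le> \<bar>y - z\<bar> / 4"
    by (intro divide_left_mono) auto
  then show ?case using IH e2 by simp
qed

lemma cfrac_conv_tendsto:
  assumes "\<And>k. k \<ge> 1 \<Longrightarrow> c k > 0"
  shows "cfrac_conv c \<longlonglongrightarrow> cfrac_value c"
proof -
  have "Cauchy (cfrac_conv c)"
  proof (rule metric_CauchyI)
    fix e :: real assume "e > 0"
    then obtain j where j: "(1/4 :: real) ^ j < e"
      using real_arch_pow_inv[of e "1/4"] by auto
    have "dist (cfrac_conv c k) (cfrac_conv c m) < e" if "k \<ge> 2 * j" "m \<ge> 2 * j" for k m
      using cfrac_conv_contract[of c j k m, OF assms] that j by (simp add: dist_real_def)
    then show "\<exists>M. \<forall>m\<ge>M. \<forall>n\<ge>M. dist (cfrac_conv c m) (cfrac_conv c n) < e" by blast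
  qed
  then show ?thesis
    unfolding cfrac_value_def by (simp add: Cauchy_convergent convergent_LIMSEQ_iff[symmetric])
qed

lemma surd_form_exists:
  assumes "quadratic_irrational x"
  shows "\<exists>a b. surd_form x a b"
proof -
  from assms obtain p q r :: rat where x: "x \<notin> \<rat>" and p: "p \<noteq> 0"
    and e: "of_rat p * x\<^sup>2 + of_rat q * x + of_rat r = 0"
    unfolding quadratic_irrational_def by auto
  define a b where "a = - q / (2 * p)" and "b = a\<^sup>2 - r / p"
  have p': "real_of_rat p \<noteq> 0" using p by simp
  have ra: "real_of_rat a = - of_rat q / (2 * of_rat p)"
    unfolding a_def by (simp add: of_rat_divide of_rat_mult of_rat_minus)
  have rb: "real_of_rat b = (of_rat a)\<^sup>2 - of_rat r / of_rat p"
    unfolding b_def by (simp add: of_rat_diff of_rat_divide of_rat_power)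
  have "(x - of_rat a)\<^sup>2 - of_rat b = (of_rat p * x\<^sup>2 + of_rat q * x + of_rat r) / of_rat p"
    unfolding rb ra using p' by (simp add: field_simps power2_eq_square)
  then have sq: "(x - of_rat a)\<^sup>2 = of_rat b" using e by simp
  have ne: "x - of_rat a \<noteq> 0" using x by (metis Rats_of_rat eq_iff_diff_eq_0)
  have "real_of_rat b > 0" using sq ne by (metis zero_less_power2)
  then have b: "b > 0" by simp
  have "b \<noteq> s\<^sup>2" for s
  proof
    assume "b = s\<^sup>2"
    then have "(x - of_rat a)\<^sup>2 = (of_rat s)\<^sup>2" using sq by (simp add: of_rat_power)
    then have "x = of_rat (a + s) \<or> x = of_rat (a - s)"
      by (auto simp: power2_eq_iff of_rat_add of_rat_diff algebra_simps)
    then show False using x by auto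
  qed
  moreover have "sqrt (of_rat b) = \<bar>x - of_rat a\<bar>" using sq real_sqrt_abs by metis
  then have "x = of_rat a + sqrt (of_rat b) \<or> x = of_rat a - sqrt (of_rat b)" by linarith
  ultimately show ?thesis using b unfolding surd_form_def by blast
qed

lemma surd_form_unique:
  assumes "surd_form x a b" and "surd_form x a' b'"
  shows "a = a' \<and> b = b'"
proof -
  have sq: "(x - of_rat u)\<^sup>2 = of_rat v" if "surd_form x u v" for u v
  proof -
    have "x - of_rat u = sqrt (of_rat v) \<or> x - of_rat u = - sqrt (of_rat v)"
      and "real_of_rat v \<ge> 0"
      using that unfolding surd_form_def by auto
    then show ?thesis by auto
  qed
  note s = sq[OF assms(1)] sq[OF assms(2)]
  have irr: "x \<notin> \<rat>"
  proof
    assume "x \<in> \<rat>"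
    then obtain y where "x = of_rat y" by (auto elim: Rats_cases)
    then have "of_rat ((y - a)\<^sup>2) = real_of_rat b" using s(1) by (simp add: of_rat_diff of_rat_power)
    then have "b = (y - a)\<^sup>2" by simp
    then show False using assms(1) unfolding surd_form_def by blast
  qed
  have aa: "a = a'"
  proof (rule ccontr)
    assume "a \<noteq> a'"
    then have ne: "real_of_rat a \<noteq> of_rat a'" by simp
    have "2 * x * (of_rat a' - of_rat a) = of_rat b - of_rat b' + (of_rat a')\<^sup>2 - (of_rat a)\<^sup>2"
      using s[symmetric] by (simp add: power2_eq_square algebra_simps)
    then have "x = (of_rat b - of_rat b' + (of_rat a')\<^sup>2 - (of_rat a)\<^sup>2) / (2 * (of_rat a' - of_rat a))"
      using ne by (simp add: field_simps)
    also have "\<dots> \<in> \<rat>" by simp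
    finally show False using irr by simp
  qed
  then have "real_of_rat b = of_rat b'" using s by simp
  then show ?thesis using aa by simp
qed

lemma rational_part_eq:
  assumes "surd_form x a b"
  shows "rational_part x = a"
  unfolding rational_part_def using assms surd_form_unique by blast

end

theory Submission
  imports Defs
begin

text \<open>
  Let \<open>p/q\<close> and \<open>p'/q'\<close> be the last two convergents of \<open>[0, c\<^sub>1, \<dots>, c\<^sub>n\<^sub>-\<^sub>1]\<close>. The complete quotient
  of \<open>x\<close> at index \<open>n\<close> is \<open>c\<^sub>n + x\<close>, so \<open>x = (p (c\<^sub>n + x) + p') / (q (c\<^sub>n + x) + q')\<close>. This is a
  quadratic equation for \<open>x\<close> with leading coefficient \<open>q\<close> and linear coefficient
  \<open>q c\<^sub>n + q' - p\<close>, whence twice the rational part is \<open>-c\<^sub>n + (p - q') / q\<close>.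
\<close>

section \<open>Bounds and recursion for infinite continued fractions\<close>

lemma cfrac_value_bounds:
  assumes "\<And>k. k \<ge> 1 \<Longrightarrow> c k > 0"
  shows "of_int (c 0) \<le> cfrac_value c" "cfrac_value c \<le> of_int (c 0) + 1"
proof -
  have lim: "cfrac_conv c \<longlonglongrightarrow> cfrac_value c"
    by (rule cfrac_conv_tendsto) (rule assms)
  show "of_int (c 0) \<le> cfrac_value c"
    by (rule LIMSEQ_le_const[OF lim]) (intro exI[of _ 0] allI impI; use cfrac_conv_bounds[of c] assms in simp)
  show "cfrac_value c \<le> of_int (c 0) + 1"
    by (rule LIMSEQ_le_const2[OF lim]) (intro exI[of _ 0] allI impI; use cfrac_conv_bounds[of c] assms in simp)
qed

lemma cfrac_value_tail_ge_1:
  assumes "\<And>k. k \<ge> 1 \<Longrightarrow> c k > 0"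
  shows "cfrac_value (\<lambda>i. c (Suc i)) \<ge> 1"
proof -
  have "real_of_int (c (Suc 0)) \<ge> 1"
    using assms[of 1] by simp
  then show ?thesis
    using cfrac_value_bounds(1)[of "\<lambda>i. c (Suc i)"] assms by fastforce
qed

text \<open>The recursion of the convergents passes to the limit: the tail converges to a value at
  least 1, where the reciprocal is continuous.\<close>

lemma cfrac_value_rec:
  assumes "\<And>k. k \<ge> 1 \<Longrightarrow> c k > 0"
  shows "cfrac_value c = of_int (c 0) + 1 / cfrac_value (\<lambda>i. c (Suc i))"
proof -
  have "cfrac_conv (\<lambda>i. c (Suc i)) \<longlonglongrightarrow> cfrac_value (\<lambda>i. c (Suc i))"
    by (rule cfrac_conv_tendsto) (use assms in simp)
  moreover have "cfrac_value (\<lambda>i. c (Suc i)) \<noteq> 0"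
    using cfrac_value_tail_ge_1[of c, OF assms] by auto
  ultimately have "(\<lambda>k. cfrac_conv c (Suc k)) \<longlonglongrightarrow> of_int (c 0) + 1 / cfrac_value (\<lambda>i. c (Suc i))"
    by (auto intro!: tendsto_intros)
  moreover have "(\<lambda>k. cfrac_conv c (Suc k)) \<longlonglongrightarrow> cfrac_value c"
    using cfrac_conv_tendsto[of c, OF assms] by (rule LIMSEQ_Suc)
  ultimately show ?thesis
    by (metis LIMSEQ_unique)
qed

text \<open>The leading digit is at least 1 and the rest adds a strictly positive reciprocal.
  Strictness is what makes denominators drop in the descent.\<close>

lemma cfrac_value_tail_gt_1:
  assumes "\<And>k. k \<ge> 1 \<Longrightarrow> c k > 0"
  shows "cfrac_value (\<lambda>i. c (Suc i)) > 1"
proof -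
  have "cfrac_value (\<lambda>i. c (Suc (Suc i))) \<ge> 1"
    using cfrac_value_tail_ge_1[of "\<lambda>i. c (Suc i)"] assms by simp
  moreover have "cfrac_value (\<lambda>i. c (Suc i)) = of_int (c 1) + 1 / cfrac_value (\<lambda>i. c (Suc (Suc i)))"
    using cfrac_value_rec[of "\<lambda>i. c (Suc i)"] assms by simp
  moreover have "real_of_int (c 1) \<ge> 1"
    using assms[of 1] by simp
  ultimately show ?thesis
    using zero_less_divide_1_iff[of "cfrac_value (\<lambda>i. c (Suc (Suc i)))"] by linarith
qed

section \<open>Irrationality of infinite continued fractions\<close>

text \<open>Descent: passing to the tail strictly decreases a denominator of the value.\<close>

lemma cfrac_value_times_nat_not_int:
  assumes "\<And>k. k \<ge> 1 \<Longrightarrow> c k > 0" and "v > 0"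
  shows "cfrac_value c * real v \<noteq> of_int u"
  using assms
proof (induction v arbitrary: c u rule: less_induct)
  case (less v)
  define y where "y = cfrac_value (\<lambda>i. c (Suc i))"
  have y: "y > 1"
    unfolding y_def using cfrac_value_tail_gt_1[of c] less.prems(1) by simp
  have x: "cfrac_value c = of_int (c 0) + 1 / y"
    unfolding y_def using cfrac_value_rec[of c] less.prems(1) by simp
  show ?case
  proof
    assume u: "cfrac_value c * real v = of_int u"
    \<comment> \<open>If the value is \<open>u / v\<close>, removing the integer digit leaves
      \<open>w / v = 1 / y\<close>. Hence \<open>y = v / w\<close>, and \<open>y > 1\<close> puts
      the new denominator \<open>w\<close> strictly between 0 and \<open>v\<close>.\<close>
    define w where "w = u - c 0 * int v"
    have w: "real_of_int w = real v / y"
      using u unfolding x w_def by (simp add: algebra_simps)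
    then have "real_of_int w > 0" "real_of_int w < real v"
      using y less.prems(2) by (simp_all only: w) (simp_all add: field_simps)
    then have w': "w > 0" "w < int v"
      by linarith+
    have "y * real (nat w) = of_int (int v)"
      using w y w' by simp
    moreover have "y * real (nat w) \<noteq> of_int (int v)"
      unfolding y_def by (rule less.IH) (use w' less.prems(1) in auto)
    ultimately show False
      by simp
  qed
qed

lemma cfrac_value_irrational:
  assumes "\<And>k. k \<ge> 1 \<Longrightarrow> c k > 0"
  shows "cfrac_value c \<notin> \<rat>"
proof
  assume "cfrac_value c \<in> \<rat>"
  then obtain u v where "v > 0" "cfrac_value c = of_int u / of_nat v"
    by (elim Rats_cases') (metis zero_less_imp_eq_int of_int_of_nat_eq of_nat_0_less_iff)
  then show False
    using cfrac_value_times_nat_not_int[of c v u] assms by simp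
qed

section \<open>Linear fractional relation between a value and its complete quotients\<close>

text \<open>
  The numbers \<open>p/q\<close> and \<open>p'/q'\<close> are the convergents of index \<open>k\<close> and \<open>k - 1\<close>; for \<open>k = 0\<close> the
  latter is the formal \<open>1/0\<close>, which forces the disjunction.
\<close>

lemma cfrac_value_moebius:
  fixes d :: "nat \<Rightarrow> int"
  assumes "\<And>i. 1 \<le> i \<Longrightarrow> i \<le> k \<Longrightarrow> d i > 0"
  shows "\<exists>p q p' q' :: int.
    (p = 0 \<and> q = 1 \<and> p' = 1 \<and> q' = 0 \<or>
     1 \<le> p \<and> p \<le> q \<and> 1 \<le> q' \<and> q' \<le> q \<and> 0 \<le> p' \<and> p' \<le> q') \<and>
    (\<forall>e. e 0 = 0 \<longrightarrow> (\<forall>i\<ge>1. e i > 0) \<longrightarrow> (\<forall>i. 1 \<le> i \<and> i \<le> k \<longrightarrow> e i = d i) \<longrightarrow>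
      cfrac_value e * (of_int q * cfrac_value (\<lambda>i. e (Suc k + i)) + of_int q') =
      of_int p * cfrac_value (\<lambda>i. e (Suc k + i)) + of_int p')"
  using assms
proof (induction k)
  case 0
  \<comment> \<open>This is the relation for the convergent 0/1 and the formal 1/0:
    \<open>p = 0\<close>, \<open>q = 1\<close>, \<open>p' = 1\<close>,
    \<open>q' = 0\<close>.\<close>
  have "cfrac_value e * cfrac_value (\<lambda>i. e (Suc i)) = 1" if "e 0 = 0" "\<forall>i\<ge>1. e i > 0" for e
    using cfrac_value_rec[of e] cfrac_value_tail_gt_1[of e] that by (simp add: field_simps)
  then show ?case
    by (intro exI[of _ 0] exI[of _ 1]) simp
next
  case (Suc k)
  then obtain p q p' q' :: int where
    inv: "p = 0 \<and> q = 1 \<and> p' = 1 \<and> q' = 0 \<or>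
      1 \<le> p \<and> p \<le> q \<and> 1 \<le> q' \<and> q' \<le> q \<and> 0 \<le> p' \<and> p' \<le> q'" and
    eq: "\<And>e. e 0 = 0 \<Longrightarrow> \<forall>i\<ge>1. e i > 0 \<Longrightarrow> \<forall>i. 1 \<le> i \<and> i \<le> k \<longrightarrow> e i = d i \<Longrightarrow>
      cfrac_value e * (of_int q * cfrac_value (\<lambda>i. e (Suc k + i)) + of_int q') =
      of_int p * cfrac_value (\<lambda>i. e (Suc k + i)) + of_int p'"
    by force
  define a where "a = d (Suc k)"
  have a: "a \<ge> 1"
    using Suc.prems[of "Suc k"] unfolding a_def by simp
  \<comment> \<open>Appending the digit \<open>a\<close> replaces \<open>p, q, p', q'\<close> by
    \<open>p * a + p', q * a + q', p, q\<close>. Either alternative of \<open>inv\<close> leads to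
    the second one.\<close>
  have inv': "1 \<le> p * a + p' \<and> p * a + p' \<le> q * a + q' \<and> 1 \<le> q \<and> q \<le> q * a + q' \<and> 0 \<le> p \<and> p \<le> q"
    using inv
  proof
    assume "p = 0 \<and> q = 1 \<and> p' = 1 \<and> q' = 0"
    then show ?thesis using a by simp
  next
    assume *: "1 \<le> p \<and> p \<le> q \<and> 1 \<le> q' \<and> q' \<le> q \<and> 0 \<le> p' \<and> p' \<le> q'"
    then have "p * 1 \<le> p * a" "q * 1 \<le> q * a" "p * a \<le> q * a"
      using a by (auto intro!: mult_left_mono mult_right_mono)
    then show ?thesis using * by linarith
  qed
  have "cfrac_value e * (of_int (q * a + q') * cfrac_value (\<lambda>i. e (Suc (Suc k) + i)) + of_int q) =
      of_int (p * a + p') * cfrac_value (\<lambda>i. e (Suc (Suc k) + i)) + of_int p"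
    if e: "e 0 = 0" "\<forall>i\<ge>1. e i > 0" "\<forall>i. 1 \<le> i \<and> i \<le> Suc k \<longrightarrow> e i = d i" for e
  proof -
    define y z where "y = cfrac_value (\<lambda>i. e (Suc k + i))"
      and "z = cfrac_value (\<lambda>i. e (Suc (Suc k) + i))"
    have z: "z > 1"
      unfolding z_def using cfrac_value_tail_gt_1[of "\<lambda>i. e (Suc k + i)"] e(2) by simp
    have "y = of_int a + 1 / z"
      unfolding y_def z_def a_def using cfrac_value_rec[of "\<lambda>i. e (Suc k + i)"] e(2,3) by simp
    then have yz: "y * z = of_int a * z + 1"
      using z by (simp add: field_simps)
    have "cfrac_value e * (of_int q * y + of_int q') = of_int p * y + of_int p'"
      unfolding y_def using eq[of e] e by simp
    \<comment> \<open>Scaling by \<open>z\<close> makes \<open>y\<close> occur only in the product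
      \<open>y * z\<close>, which \<open>yz\<close> eliminates.\<close>
    then have "cfrac_value e * (of_int q * (y * z) + of_int q' * z) = of_int p * (y * z) + of_int p' * z"
      by algebra
    then show ?thesis
      unfolding yz z_def[symmetric] by (simp add: algebra_simps)
  qed
  then show ?case
    using inv' by blast
qed

section \<open>Rational parts and quadratic equations\<close>

text \<open>The surd form gives a second rational quadratic, \<open>(x - a)\<^sup>2 = b\<close>.
  Eliminating \<open>x\<^sup>2\<close> leaves a linear relation, whose coefficient of
  \<open>x\<close> must vanish because \<open>x\<close> is irrational.\<close>

lemma rational_part_of_quadratic:
  fixes p q r :: rat
  assumes x: "x \<notin> \<rat>" and p: "p \<noteq> 0"
    and eq: "of_rat p * x\<^sup>2 + of_rat q * x + of_rat r = 0"
  shows "2 * rational_part x = - q / p"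
proof -
  have "quadratic_irrational x"
    unfolding quadratic_irrational_def using assms by blast
  then obtain a b where ab: "surd_form x a b"
    using surd_form_exists by blast
  then have "(x - of_rat a)\<^sup>2 = of_rat b"
    unfolding surd_form_def by auto
  then have sq: "x\<^sup>2 = 2 * of_rat a * x - (of_rat a)\<^sup>2 + of_rat b"
    by (simp add: power2_eq_square algebra_simps)
  have lin: "x * of_rat (2 * a * p + q) = of_rat ((a\<^sup>2 - b) * p - r)"
    using eq unfolding sq by (simp add: of_rat_add of_rat_mult of_rat_diff of_rat_power algebra_simps)
  have "2 * a * p + q = 0"
  proof (rule ccontr)
    assume "2 * a * p + q \<noteq> 0"
    then have "x = of_rat (((a\<^sup>2 - b) * p - r) / (2 * a * p + q))"
      using lin unfolding of_rat_divide
      by (metis nonzero_eq_divide_eq of_rat_eq_0_iff)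
    then show False using x by simp
  qed
  then show ?thesis
    using p rational_part_eq[OF ab] by (simp add: field_simps eq_neg_iff_add_eq_0)
qed

section \<open>Periodic expansions\<close>

lemma periodic_digits_pos:
  assumes "n \<ge> 1" and "\<And>i. 1 \<le> i \<Longrightarrow> i \<le> n \<Longrightarrow> c i > 0" and "k \<ge> 1"
  shows "periodic_digits n c k > 0"
  using assms(2)[of "(k - 1) mod n + 1"] assms(1,3) mod_less_divisor[of n "k - 1"]
  unfolding periodic_digits_def by (simp add: Suc_le_eq)

text \<open>Shifting by one period changes only the digit at index 0, from the initial 0 to
  \<open>c n\<close>.\<close>

lemma periodic_cfrac_complete_quotient:
  assumes "n \<ge> 1" and "\<And>i. 1 \<le> i \<Longrightarrow> i \<le> n \<Longrightarrow> c i > 0"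
  shows "cfrac_value (\<lambda>i. periodic_digits n c (n + i)) = of_int (c n) + periodic_cfrac n c"
proof -
  let ?d = "periodic_digits n c"
  have pos: "?d k > 0" if "k \<ge> 1" for k
    using periodic_digits_pos[of n c k] assms that by simp
  have "?d (n + Suc i) = ?d (Suc i)" for i
    by (simp add: periodic_digits_def)
  moreover have "?d n = c n"
    using assms(1) by (simp add: periodic_digits_def)
  ultimately have "cfrac_value (\<lambda>i. ?d (n + i)) = of_int (c n) + 1 / cfrac_value (\<lambda>i. ?d (Suc i))"
    using cfrac_value_rec[of "\<lambda>i. ?d (n + i)"] pos by simp
  moreover have "periodic_cfrac n c = 1 / cfrac_value (\<lambda>i. ?d (Suc i))"
    using cfrac_value_rec[of ?d, OF pos] by (simp add: periodic_cfrac_def periodic_digits_def)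
  ultimately show ?thesis
    by simp
qed

lemma periodic_cfrac_irrational:
  assumes "n \<ge> 1" and "\<And>i. 1 \<le> i \<Longrightarrow> i \<le> n \<Longrightarrow> c i > 0"
  shows "periodic_cfrac n c \<notin> \<rat>"
  unfolding periodic_cfrac_def
  by (rule cfrac_value_irrational) (use periodic_digits_pos[of n c] assms in blast)

theorem theorem1:
  fixes n :: nat and c :: "nat \<Rightarrow> int"
  assumes "n \<ge> 1" and "\<And>i. 1 \<le> i \<Longrightarrow> i \<le> n \<Longrightarrow> c i > 0"
  shows "quadratic_irrational (periodic_cfrac n c) \<and>
    (\<exists>\<epsilon> :: rat. \<bar>\<epsilon>\<bar> < 1 \<and>
       2 * rational_part (periodic_cfrac n c) = - of_int (c n) + \<epsilon> \<and>
       (\<forall>m > 0. 2 * rational_part (periodic_cfrac n (c(n := m))) + of_int m = \<epsilon>)) \<and>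
    (\<forall>m > 0. frac (2 * rational_part (periodic_cfrac n (c(n := m)))) =
             frac (2 * rational_part (periodic_cfrac n c)))"
proof -
  \<comment> \<open>The coefficients are chosen before \<open>e\<close>, so one quadruple serves
    every last digit; this yields the independence of \<open>c n\<close>.\<close>
  obtain p q p' q' :: int where
    inv: "p = 0 \<and> q = 1 \<and> p' = 1 \<and> q' = 0 \<or>
      1 \<le> p \<and> p \<le> q \<and> 1 \<le> q' \<and> q' \<le> q \<and> 0 \<le> p' \<and> p' \<le> q'" and
    eq: "\<And>e. e 0 = 0 \<Longrightarrow> \<forall>i\<ge>1. e i > 0 \<Longrightarrow> \<forall>i. 1 \<le> i \<and> i \<le> n - 1 \<longrightarrow> e i = c i \<Longrightarrow>
      cfrac_value e * (of_int q * cfrac_value (\<lambda>i. e (Suc (n - 1) + i)) + of_int q') =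
      of_int p * cfrac_value (\<lambda>i. e (Suc (n - 1) + i)) + of_int p'"
    using cfrac_value_moebius[of "n - 1" c] assms(2) by force
  define \<epsilon> :: rat where "\<epsilon> = of_int (p - q') / of_int q"
  \<comment> \<open>Either \<open>p = q' = 0\<close> and \<open>q = 1\<close>, or both
    \<open>p\<close> and \<open>q'\<close> lie between 1 and \<open>q\<close>, so that they differ
    by at most \<open>q - 1\<close>.\<close>
  have q: "q > 0" and pq: "\<bar>p - q'\<bar> < q"
    using inv by auto
  have "\<bar>\<epsilon>\<bar> = of_int \<bar>p - q'\<bar> / of_int q"
    unfolding \<epsilon>_def using q by simp
  also have "\<dots> < 1"
    using q pq by (simp only: divide_less_eq_1_pos of_int_0_less_iff of_int_less_iff)
  finally have \<epsilon>: "\<bar>\<epsilon>\<bar> < 1" .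
  \<comment> \<open>An arbitrary last digit \<open>m\<close> also covers the original expansion,
    since \<open>c(n := c n)\<close> is \<open>c\<close>.\<close>
  have quad: "quadratic_irrational (periodic_cfrac n (c(n := m))) \<and>
      2 * rational_part (periodic_cfrac n (c(n := m))) = - of_int m + \<epsilon>" if m: "m > 0" for m
  proof -
    let ?c = "c(n := m)"
    define x where "x = periodic_cfrac n ?c"
    have pos: "?c i > 0" if "1 \<le> i" "i \<le> n" for i
      using assms(2) m that by simp
    have "periodic_digits n ?c i = c i" if "1 \<le> i" "i \<le> n - 1" for i
    proof -
      have "(i - 1) mod n = i - 1" "i \<noteq> n" using that by auto
      then show ?thesis using that by (simp add: periodic_digits_def)
    qed
    \<comment> \<open>As \<open>n \<ge> 1\<close>, the index \<open>Suc (n - 1)\<close> is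
      \<open>n\<close>, so the tail in \<open>eq\<close> is the complete quotient
      \<open>m + x\<close>.\<close>
    then have "x * (of_int q * (of_int m + x) + of_int q') = of_int p * (of_int m + x) + of_int p'"
      using eq[of "periodic_digits n ?c"] periodic_cfrac_complete_quotient[of n ?c, OF assms(1) pos]
        periodic_digits_pos[of n ?c, OF assms(1) pos] assms(1)
      by (simp add: x_def periodic_cfrac_def periodic_digits_def[of n _ 0])
    then have x: "of_rat (of_int q) * x\<^sup>2 + of_rat (of_int (q * m + q' - p)) * x
        + of_rat (of_int (- (p * m + p'))) = 0"
      unfolding of_rat_of_int_eq by (simp add: power2_eq_square algebra_simps)
    have irr: "x \<notin> \<rat>"
      unfolding x_def by (rule periodic_cfrac_irrational[OF assms(1) pos])
    have q0: "(of_int q :: rat) \<noteq> 0"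
      using q by simp
    have "quadratic_irrational x"
      unfolding quadratic_irrational_def using irr q0 x by blast
    moreover have "2 * rational_part x = - of_int m + \<epsilon>"
      unfolding rational_part_of_quadratic[OF irr q0 x] \<epsilon>_def using q by (simp add: field_simps)
    ultimately show ?thesis
      unfolding x_def by simp
  qed
  have "c n > 0"
    using assms by simp
  from quad[OF this] have c: "quadratic_irrational (periodic_cfrac n c)"
    "2 * rational_part (periodic_cfrac n c) = - of_int (c n) + \<epsilon>"
    by simp_all
  moreover have "frac (- of_int m + \<epsilon>) = frac \<epsilon>" for m
    using floor_add_int[of \<epsilon> "- m"] by (simp add: frac_def)
  ultimately show ?thesis
    using quad \<epsilon> by auto
qed

end
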